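(* Let $\Omega\subset\mathbb{R}^d$ be open, let $x,y\in \Omega$ be distinct and let $\mu:= \frac{1}{2} \delta_{x} + \frac{1}{2} \delta_{y}$. Then, for all $\lambda\geq 0$, there exists a function $\Phi:\mathfrak{F}(\Omega;\mu) \rightarrow \mathbb{R}$ which is continuous with respect to the topology of $L^2(\Omega;\mu)$ and $\lambda$-convex (on the Hilbert space $L^2(\Omega;\mu)=\mathfrak{F}(\Omega;\mu)$), yet which is not $P_0$-convex on $L^2(\Omega;\mu)$.
   Context: $\mathfrak{F}(\Omega;\mu)$ is the vector space of real-valued Borel-measurable functions on $\Omega$ modulo equality $\mu$-a.e.; for this $\mu$ it coincides with $L^2(\Omega;\mu)$. A function $\Phi:H\to(-\infty,+\infty]$ on a Hilbert space is $\lambda$-convex if $\Phi(tu+(1-t)v)\le t\Phi(u)+(1-t)\Phi(v)-\frac12\lambda t(1-t)\|u-v\|^2$ for all $u,v\in H$, $t\in[0,1]$. $P_0:=\{g\in C^\infty(\mathbb{R}): 0\notin\operatorname{spt}(g),\ \operatorname{spt}(g')\text{ is compact},\ 0\le g'\le1\}$, where $\operatorname{spt}$ denotes support. For a convex subset $X\subset\mathfrak{F}(\Omega;\mu)$, $\Phi:\mathfrak{F}(\Omega;\mu)\to(-\infty,+\infty]$ is $P_0$-convex on $X$ if $\Phi(u+g\circ(v-u))+\Phi(v-g\circ(v-u))\le\Phi(u)+\Phi(v)$ for all $u,v\in X$ and $g\in P_0$. *)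

theory Defs
  imports "HOL-Probability.Probability"
begin

section \<open>Measurable functions modulo almost everywhere equality\<close>

definition ae_class :: "'a measure \<Rightarrow> ('a \<Rightarrow> real) \<Rightarrow> ('a \<Rightarrow> real) set" where
  "ae_class M u = {v \<in> borel_measurable M. AE w in M. v w = u w}"

definition F_space :: "'a measure \<Rightarrow> ('a \<Rightarrow> real) set set" where
  "F_space M = ae_class M ` borel_measurable M"

definition square_integrable :: "'a measure \<Rightarrow> ('a \<Rightarrow> real) set" where
  "square_integrable M = {u \<in> borel_measurable M. integrable M (\<lambda>w. (u w)\<^sup>2)}"

definition L2_space :: "'a measure \<Rightarrow> ('a \<Rightarrow> real) set set" where
  "L2_space M = ae_class M ` square_integrable M"

definition L2_norm :: "'a measure \<Rightarrow> ('a \<Rightarrow> real) \<Rightarrow> real" where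
  "L2_norm M u = sqrt (LINT w|M. (u w)\<^sup>2)"

text \<open>The choice of representatives is immaterial, see \<open>L2_dist_ae_class\<close> below.\<close>

definition L2_dist :: "'a measure \<Rightarrow> ('a \<Rightarrow> real) set \<Rightarrow> ('a \<Rightarrow> real) set \<Rightarrow> real" where
  "L2_dist M U V = L2_norm M (\<lambda>w. (SOME u. u \<in> U) w - (SOME v. v \<in> V) w)"

definition L2_topology :: "'a measure \<Rightarrow> ('a \<Rightarrow> real) set topology" where
  "L2_topology M = Metric_space.mtopology (L2_space M) (L2_dist M)"

lemma ae_class_eq_iff:
  assumes "u \<in> borel_measurable M" "v \<in> borel_measurable M"
  shows "ae_class M u = ae_class M v \<longleftrightarrow> (AE w in M. u w = v w)"
proof
  assume "ae_class M u = ae_class M v"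
  moreover have "u \<in> ae_class M u" using assms by (simp add: ae_class_def)
  ultimately show "AE w in M. u w = v w" by (simp add: ae_class_def)
next
  assume "AE w in M. u w = v w"
  then show "ae_class M u = ae_class M v" unfolding ae_class_def by auto
qed

lemma some_ae_class:
  assumes "u \<in> borel_measurable M"
  shows "(SOME v. v \<in> ae_class M u) \<in> ae_class M u"
  by (rule someI[of _ u]) (use assms in \<open>simp add: ae_class_def\<close>)

lemma L2_dist_ae_class:
  assumes "u \<in> borel_measurable M" "v \<in> borel_measurable M"
  shows "L2_dist M (ae_class M u) (ae_class M v) = L2_norm M (\<lambda>w. u w - v w)"
proof -
  let ?u = "SOME f. f \<in> ae_class M u" and ?v = "SOME f. f \<in> ae_class M v"
  have u: "?u \<in> borel_measurable M" "AE w in M. ?u w = u w"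
    using some_ae_class[OF assms(1)] by (auto simp: ae_class_def)
  have v: "?v \<in> borel_measurable M" "AE w in M. ?v w = v w"
    using some_ae_class[OF assms(2)] by (auto simp: ae_class_def)
  have "(LINT w|M. (?u w - ?v w)\<^sup>2) = (LINT w|M. (u w - v w)\<^sup>2)"
    by (intro integral_cong_AE) (use u v assms in auto)
  then show ?thesis by (simp add: L2_dist_def L2_norm_def)
qed

lemma square_integrable_mult:
  assumes "u \<in> square_integrable M" "v \<in> square_integrable M"
  shows "integrable M (\<lambda>w. u w * v w)"
proof -
  have i: "integrable M (\<lambda>w. (u w)\<^sup>2)" "integrable M (\<lambda>w. (v w)\<^sup>2)"
    and [measurable]: "u \<in> borel_measurable M" "v \<in> borel_measurable M"
    using assms by (auto simp: square_integrable_def)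
  have b: "norm (u w * v w) \<le> norm ((u w)\<^sup>2 + (v w)\<^sup>2)" for w
  proof -
    have "0 \<le> (\<bar>u w\<bar> - \<bar>v w\<bar>)\<^sup>2" "0 \<le> (u w)\<^sup>2 + (v w)\<^sup>2" by auto
    then have "2 * (\<bar>u w\<bar> * \<bar>v w\<bar>) \<le> (u w)\<^sup>2 + (v w)\<^sup>2"
      by (simp add: power2_diff)
    moreover have "0 \<le> \<bar>u w\<bar> * \<bar>v w\<bar>" by simp
    ultimately have "\<bar>u w\<bar> * \<bar>v w\<bar> \<le> (u w)\<^sup>2 + (v w)\<^sup>2" by linarith
    then show ?thesis by (simp add: abs_mult)
  qed
  show ?thesis
    by (rule Bochner_Integration.integrable_bound[OF Bochner_Integration.integrable_add[OF i]])
      (use b in auto)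
qed

lemma square_integrable_lincomb:
  assumes "u \<in> square_integrable M" "v \<in> square_integrable M"
  shows "(\<lambda>w. a * u w + b * v w) \<in> square_integrable M"
proof -
  have i: "integrable M (\<lambda>w. (u w)\<^sup>2)" "integrable M (\<lambda>w. (v w)\<^sup>2)"
    and [measurable]: "u \<in> borel_measurable M" "v \<in> borel_measurable M"
    using assms by (auto simp: square_integrable_def)
  have e: "(a * u w + b * v w)\<^sup>2 = a\<^sup>2 * (u w)\<^sup>2 + b\<^sup>2 * (v w)\<^sup>2 + 2 * a * b * (u w * v w)" for w
    by (simp add: power2_eq_square algebra_simps)
  have "integrable M (\<lambda>w. (a * u w + b * v w)\<^sup>2)"
    unfolding e using i square_integrable_mult[OF assms]
    by (intro Bochner_Integration.integrable_add integrable_mult_right)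
  then show ?thesis by (simp add: square_integrable_def)
qed

lemma square_integrable_diff:
  assumes "u \<in> square_integrable M" "v \<in> square_integrable M"
  shows "(\<lambda>w. u w - v w) \<in> square_integrable M"
  using square_integrable_lincomb[OF assms, of 1 "-1"] by simp

lemma L2_norm_triangle:
  assumes "u \<in> square_integrable M" "v \<in> square_integrable M"
  shows "L2_norm M (\<lambda>w. u w + v w) \<le> L2_norm M u + L2_norm M v"
proof -
  define A B C where "A = (LINT w|M. (u w)\<^sup>2)" and "B = (LINT w|M. (v w)\<^sup>2)"
    and "C = (LINT w|M. u w * v w)"
  have i: "integrable M (\<lambda>w. (u w)\<^sup>2)" "integrable M (\<lambda>w. (v w)\<^sup>2)"
    "integrable M (\<lambda>w. u w * v w)"
    using assms square_integrable_mult[OF assms] by (auto simp: square_integrable_def)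
  have quad: "(LINT w|M. (a * u w + b * v w)\<^sup>2) = a\<^sup>2 * A + b\<^sup>2 * B + 2 * a * b * C" for a b
  proof -
    have "(LINT w|M. (a * u w + b * v w)\<^sup>2) =
      (LINT w|M. a\<^sup>2 * (u w)\<^sup>2 + b\<^sup>2 * (v w)\<^sup>2 + 2 * a * b * (u w * v w))"
      by (intro Bochner_Integration.integral_cong) (auto simp: power2_eq_square algebra_simps)
    also have "\<dots> = a\<^sup>2 * A + b\<^sup>2 * B + 2 * a * b * C"
      using i by (simp add: A_def B_def C_def)
    finally show ?thesis .
  qed
  have AB: "0 \<le> A" "0 \<le> B" by (auto simp: A_def B_def)
  have nn: "0 \<le> a\<^sup>2 * A + b\<^sup>2 * B + 2 * a * b * C" for a b
    unfolding quad[symmetric] by simp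
  have "C\<^sup>2 \<le> A * B"
  proof (cases "A = 0")
    case True
    have "C = 0"
    proof (rule ccontr)
      assume "C \<noteq> 0"
      then have "2 * (- (B + 1) / (2 * C)) * 1 * C = - (B + 1)" by (simp add: field_simps)
      with nn[of "- (B + 1) / (2 * C)" 1] True show False by simp
    qed
    then show ?thesis using True by simp
  next
    case False
    have "0 \<le> A * (A * B - C\<^sup>2)"
      using nn[of "-C" A] by (simp add: power2_eq_square algebra_simps)
    with False AB show ?thesis by (simp add: zero_le_mult_iff)
  qed
  then have "C \<le> sqrt A * sqrt B"
    by (metis real_le_rsqrt real_sqrt_mult)
  then have "A + B + 2 * C \<le> (sqrt A + sqrt B)\<^sup>2"
    using AB by (simp add: power2_sum)
  then have "sqrt (A + B + 2 * C) \<le> sqrt A + sqrt B"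
    using AB by (simp add: real_le_lsqrt)
  then show ?thesis
    using quad[of 1 1] by (simp add: L2_norm_def A_def B_def)
qed

lemma Metric_space_L2: "Metric_space (L2_space M) (L2_dist M)"
proof
  fix U V W
  show "0 \<le> L2_dist M U V" by (simp add: L2_dist_def L2_norm_def)
  show "L2_dist M U V = L2_dist M V U"
    by (simp add: L2_dist_def L2_norm_def power2_commute)
  assume "U \<in> L2_space M" "V \<in> L2_space M"
  then obtain u v where u: "u \<in> square_integrable M" "U = ae_class M u"
    and v: "v \<in> square_integrable M" "V = ae_class M v"
    by (auto simp: L2_space_def)
  have m: "u \<in> borel_measurable M" "v \<in> borel_measurable M"
    using u v by (auto simp: square_integrable_def)
  have "integrable M (\<lambda>w. (u w - v w)\<^sup>2)"
    using square_integrable_diff[OF u(1) v(1)] by (simp add: square_integrable_def)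
  then show "L2_dist M U V = 0 \<longleftrightarrow> U = V"
    using m by (simp add: u v L2_dist_ae_class ae_class_eq_iff L2_norm_def
        integral_nonneg_eq_0_iff_AE)
  assume "W \<in> L2_space M"
  then obtain z where z: "z \<in> square_integrable M" "W = ae_class M z"
    by (auto simp: L2_space_def)
  then have mz: "z \<in> borel_measurable M" by (auto simp: square_integrable_def)
  show "L2_dist M U W \<le> L2_dist M U V + L2_dist M V W"
    using L2_norm_triangle[OF square_integrable_diff[OF u(1) v(1)]
        square_integrable_diff[OF v(1) z(1)]] m mz
    by (simp add: u v z L2_dist_ae_class)
qed

section \<open>Notions of convexity\<close>

text \<open>
  Functionals with values in \<open>(-\<infinity>, +\<infinity>]\<close> are typed into \<^typ>\<open>ereal\<close>; the
  definitions below are meant for functionals that do not attain \<open>-\<infinity>\<close>.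
  Classes are quantified over via representatives.
\<close>

definition lambda_convex_L2 ::
    "'a measure \<Rightarrow> real \<Rightarrow> (('a \<Rightarrow> real) set \<Rightarrow> ereal) \<Rightarrow> bool" where
  "lambda_convex_L2 M l \<Phi> \<longleftrightarrow>
    (\<forall>u \<in> square_integrable M. \<forall>v \<in> square_integrable M. \<forall>t \<in> {0..1}.
      \<Phi> (ae_class M (\<lambda>w. t * u w + (1 - t) * v w))
        \<le> ereal t * \<Phi> (ae_class M u) + ereal (1 - t) * \<Phi> (ae_class M v)
          - ereal (1 / 2 * l * t * (1 - t) * (L2_norm M (\<lambda>w. u w - v w))\<^sup>2))"

definition smooth :: "(real \<Rightarrow> real) \<Rightarrow> bool" where
  "smooth g \<longleftrightarrow> (\<forall>n. (deriv ^^ n) g differentiable_on UNIV)"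

definition spt :: "(real \<Rightarrow> real) \<Rightarrow> real set" where
  "spt g = closure {s. g s \<noteq> 0}"

definition P0 :: "(real \<Rightarrow> real) set" where
  "P0 = {g. smooth g \<and> 0 \<notin> spt g \<and> compact (spt (deriv g)) \<and>
            (\<forall>s. 0 \<le> deriv g s \<and> deriv g s \<le> 1)}"

definition P0_convex_on ::
    "'a measure \<Rightarrow> ('a \<Rightarrow> real) set set \<Rightarrow> (('a \<Rightarrow> real) set \<Rightarrow> ereal) \<Rightarrow> bool" where
  "P0_convex_on M X \<Phi> \<longleftrightarrow>
    (\<forall>u \<in> borel_measurable M. \<forall>v \<in> borel_measurable M. \<forall>g \<in> P0.
      ae_class M u \<in> X \<longrightarrow> ae_class M v \<in> X \<longrightarrow>
      \<Phi> (ae_class M (\<lambda>w. u w + g (v w - u w))) + \<Phi> (ae_class M (\<lambda>w. v w - g (v w - u w)))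
        \<le> \<Phi> (ae_class M u) + \<Phi> (ae_class M v))"

section \<open>The two-point measure\<close>

text \<open>\<open>\<delta>\<^sub>x / 2 + \<delta>\<^sub>y / 2\<close> on the Borel sets of \<open>\<Omega>\<close>.\<close>

definition two_point_measure ::
    "'a::topological_space set \<Rightarrow> 'a \<Rightarrow> 'a \<Rightarrow> 'a measure" where
  "two_point_measure \<Omega> x y =
    (let B = restrict_space borel \<Omega> in
      measure_of \<Omega> (sets B)
        (\<lambda>A. 1 / 2 * emeasure (return B x) A + 1 / 2 * emeasure (return B y) A))"

lemma space_two_point_measure [simp]: "space (two_point_measure \<Omega> x y) = \<Omega>"
  by (simp add: two_point_measure_def Let_def space_measure_of_conv)

lemma sets_two_point_measure [simp, measurable_cong]:
  "sets (two_point_measure \<Omega> x y) = sets (restrict_space borel \<Omega>)"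
proof -
  have "space (restrict_space borel \<Omega>) = \<Omega>" by (simp add: space_restrict_space)
  then show ?thesis
    unfolding two_point_measure_def Let_def
    by (metis sets.sets_measure_of_eq sets_measure_of_conv sets.space_closed sets.sigma_sets_eq)
qed

lemma emeasure_two_point_measure:
  assumes "A \<in> sets (restrict_space borel \<Omega>)"
  shows "emeasure (two_point_measure \<Omega> x y) A = 1 / 2 * indicator A x + 1 / 2 * indicator A y"
proof -
  let ?B = "restrict_space borel \<Omega>"
  let ?m = "\<lambda>A. 1 / 2 * emeasure (return ?B x) A + 1 / 2 * emeasure (return ?B y) A"
  have sp: "space ?B = \<Omega>" by (simp add: space_restrict_space)
  have "sigma_algebra \<Omega> (sets ?B)"
    using sets.sigma_algebra_axioms[of ?B] by (simp only: sp)
  moreover have "positive (sets ?B) ?m" by (simp add: positive_def)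
  moreover have "countably_additive (sets ?B) ?m"
  proof (rule countably_additiveI)
    fix D :: "nat \<Rightarrow> _"
    assume D: "range D \<subseteq> sets ?B" "disjoint_family D"
    then show "(\<Sum>i. ?m (D i)) = ?m (\<Union>i. D i)"
      by (simp add: suminf_add[symmetric] ennreal_suminf_cmult suminf_emeasure del: emeasure_return)
  qed
  ultimately have "emeasure (two_point_measure \<Omega> x y) A = ?m A"
    unfolding two_point_measure_def Let_def using assms by (rule emeasure_measure_of_sigma)
  then show ?thesis using assms by simp
qed

lemma L2_space_two_point_measure:
  fixes x y :: "'a::t1_space"
  assumes "x \<in> \<Omega>" "y \<in> \<Omega>"
  shows "L2_space (two_point_measure \<Omega> x y) = F_space (two_point_measure \<Omega> x y)"
proof -
  let ?M = "two_point_measure \<Omega> x y"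
  have "integrable ?M (\<lambda>w. (u w)\<^sup>2)" if u: "u \<in> borel_measurable ?M"
    for u :: "'a \<Rightarrow> real"
  proof (rule integrableI_bounded_set[where A = \<Omega> and B = "max ((u x)\<^sup>2) ((u y)\<^sup>2)"])
    have O: "\<Omega> \<in> sets (restrict_space borel \<Omega>)"
      using sets.top[of "restrict_space borel \<Omega>"] by (simp add: space_restrict_space)
    then show "\<Omega> \<in> sets ?M" by simp
    show "(\<lambda>w. (u w)\<^sup>2) \<in> borel_measurable ?M" using u by simp
    show "emeasure ?M \<Omega> < \<infinity>"
      by (simp add: emeasure_two_point_measure O less_top[symmetric] ennreal_divide_eq_top_iff assms)
    let ?N = "\<Omega> - {x, y}"
    have N: "?N \<in> sets (restrict_space borel \<Omega>)"
      by (auto simp: sets_restrict_space intro!: image_eqI[of _ _ "- {x, y}"] borel_open open_Compl finite_imp_closed)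
    have "emeasure ?M ?N = 0" by (simp add: emeasure_two_point_measure[OF N])
    then show "AE w in ?M. w \<in> \<Omega> \<longrightarrow> norm ((u w)\<^sup>2) \<le> max ((u x)\<^sup>2) ((u y)\<^sup>2)"
      by (intro AE_I[where N = ?N]) (use N in auto)
    show "AE w in ?M. w \<notin> \<Omega> \<longrightarrow> (u w)\<^sup>2 = 0" by (rule AE_I2) simp
  qed
  then show ?thesis by (auto simp: L2_space_def F_space_def square_integrable_def)
qed

end

theory Submission
  imports Defs
begin

text \<open>
  On \<open>L\<^sup>2(\<mu>) \<cong> \<real>\<^sup>2\<close>, with coordinates \<open>a = u(x)\<close> and \<open>b = u(y)\<close>, take the quadratic functional
  \<open>Q(a, b) = \<lambda>/4 (a\<^sup>2 + b\<^sup>2) + (\<lambda> + 1) (a + b)\<^sup>2\<close>. Its first term is exactly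
  \<open>\<lambda>/2 \<parallel>u\<parallel>\<^sup>2\<close> and its second one is convex, so it is \<open>\<lambda>\<close>-convex. If \<open>B\<close> denotes the associated
  bilinear form, \<open>p = g \<circ> (v - u)\<close> and \<open>q = v - u - p\<close>, then the \<open>P\<^sub>0\<close>-convexity
  inequality says \<open>B(p, q) \<ge> 0\<close>. For \<open>v - u = (2, -4)\<close> and a \<open>g\<close> vanishing on the
  negative numbers with \<open>g(2) > 0\<close>, we have \<open>p = (g(2), 0)\<close>, and the positive correlation
  between the two coordinates makes \<open>B(p, q)\<close> negative.
\<close>

section \<open>Smooth functions\<close>

text \<open>Every iterated derivative stays in \<open>S\<close>, so no formula for the
  \<open>n\<close>-th derivative has to be found: exhibiting a family closed under differentiation
  is enough.\<close>

lemma smooth_coinduct: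
  assumes "f \<in> S"
    and S: "\<And>f. f \<in> S \<Longrightarrow> \<exists>f'\<in>S. \<forall>s. (f has_real_derivative f' s) (at s)"
  shows "smooth f"
proof -
  have *: "(deriv ^^ n) f \<in> S" for n
  proof (induction n)
    case (Suc n)
    then obtain f' where "f' \<in> S" "\<forall>s. ((deriv ^^ n) f has_real_derivative f' s) (at s)"
      using S by blast
    moreover from this have "deriv ((deriv ^^ n) f) = f'"
      by (auto intro: DERIV_imp_deriv)
    ultimately show ?case by simp
  qed (use assms in simp)
  show ?thesis
    unfolding smooth_def differentiable_on_def
    using S[OF *] real_differentiable_def by (metis UNIV_I differentiable_at_withinI)
qed

text \<open>Sums and products are what the product rule creates, so closure of the generators under
  differentiation passes to the hull.\<close>

inductive_set algebra_hull :: "(real \<Rightarrow> real) set \<Rightarrow> (real \<Rightarrow> real) set" for S where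
  base: "f \<in> S \<Longrightarrow> f \<in> algebra_hull S"
| add: "f \<in> algebra_hull S \<Longrightarrow> g \<in> algebra_hull S \<Longrightarrow> (\<lambda>s. f s + g s) \<in> algebra_hull S"
| mult: "f \<in> algebra_hull S \<Longrightarrow> g \<in> algebra_hull S \<Longrightarrow> (\<lambda>s. f s * g s) \<in> algebra_hull S"

lemma algebra_hull_closed_under_derivative:
  assumes "f \<in> algebra_hull S"
    and S: "\<And>f. f \<in> S \<Longrightarrow> \<exists>f'\<in>S. \<forall>s. (f has_real_derivative f' s) (at s)"
  shows "\<exists>f'\<in>algebra_hull S. \<forall>s. (f has_real_derivative f' s) (at s)"
  using assms(1)
proof induction
  case (base f)
  then show ?case using S algebra_hull.base by blast
next
  case (add f g)
  then obtain f' g' where "f' \<in> algebra_hull S" "g' \<in> algebra_hull S"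
    "\<forall>s. (f has_real_derivative f' s) (at s)" "\<forall>s. (g has_real_derivative g' s) (at s)"
    by blast
  then show ?case
    by (intro bexI[of _ "\<lambda>s. f' s + g' s"]) (auto intro: algebra_hull.add DERIV_add)
next
  case (mult f g)
  then obtain f' g' where "f' \<in> algebra_hull S" "g' \<in> algebra_hull S"
    "\<forall>s. (f has_real_derivative f' s) (at s)" "\<forall>s. (g has_real_derivative g' s) (at s)"
    by blast
  with mult show ?case
    by (intro bexI[of _ "\<lambda>s. f' s * g s + g' s * f s"])
      (auto intro!: algebra_hull.add algebra_hull.mult DERIV_mult)
qed

section \<open>Flat functions built from \<open>exp (- (1 / s))\<close>\<close>

definition flat_exp :: "real poly \<Rightarrow> real \<Rightarrow> real" where
  "flat_exp p s = (if s > 0 then poly p (1 / s) * exp (- (1 / s)) else 0)"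

lemma tendsto_poly_times_exp_minus: "((\<lambda>t::real. poly p t * exp (- t)) \<longlongrightarrow> 0) at_top"
proof -
  have "((\<lambda>t. \<Sum>i\<le>degree p. coeff p i * (t ^ i / exp t)) \<longlongrightarrow> (\<Sum>i\<le>degree p. coeff p i * 0)) at_top"
    by (intro tendsto_intros tendsto_power_div_exp_0)
  then show ?thesis
    by (simp add: poly_altdef exp_minus sum_distrib_right divide_inverse mult.assoc)
qed

text \<open>With \<open>t = 1 / s\<close> one has \<open>d/ds = - t^2 d/dt\<close>, which turns
  \<open>p(t) exp(-t)\<close> into \<open>t^2 (p - p')(t) exp(-t)\<close>. The polynomial factor
  thus makes the family closed under differentiation, also across \<open>s = 0\<close>.\<close>

lemma has_derivative_flat_exp:
  "(flat_exp p has_real_derivative flat_exp ([:0, 0, 1:] * (p - pderiv p)) s) (at s)"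
proof -
  consider "s < 0" | "s = 0" | "s > 0" by linarith
  then show ?thesis
  proof cases
    case 1
    have "((\<lambda>_. 0) has_real_derivative 0) (at s)" by simp
    then have "(flat_exp p has_real_derivative 0) (at s)"
      by (rule has_field_derivative_transform_within_open[of _ _ _ "{..<0}"])
        (use 1 in \<open>auto simp: flat_exp_def\<close>)
    then show ?thesis using 1 by (simp add: flat_exp_def)
  next
    case 2
    \<comment> \<open>Dividing by \<open>h\<close> multiplies the polynomial in \<open>1 / h\<close>
      by its variable, so the difference quotient at 0 is again a polynomial times a decaying
      exponential.\<close>
    have "((\<lambda>h. poly ([:0, 1:] * p) (inverse h) * exp (- inverse h)) \<longlongrightarrow> 0) (at_right 0)"
      by (rule filterlim_compose[OF tendsto_poly_times_exp_minus filterlim_inverse_at_top_right])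
    then have "((\<lambda>h. flat_exp p h / h) \<longlongrightarrow> 0) (at_right 0)"
      by (rule Lim_transform_eventually)
        (auto simp: eventually_at_filter flat_exp_def field_simps)
    moreover have "((\<lambda>h. flat_exp p h / h) \<longlongrightarrow> 0) (at_left 0)"
      by (rule Lim_transform_eventually[OF tendsto_const])
        (auto simp: eventually_at_filter flat_exp_def)
    ultimately have "((\<lambda>h. flat_exp p h / h) \<longlongrightarrow> 0) (at 0)"
      by (simp add: filterlim_split_at)
    then show ?thesis using 2 by (simp add: DERIV_def flat_exp_def)
  next
    case 3
    have "((\<lambda>s. poly p (1 / s) * exp (- (1 / s))) has_real_derivative
        poly p (1 / s) * (exp (- (1 / s)) * (1 / s\<^sup>2)) + poly (pderiv p) (1 / s) * (- (1 / s\<^sup>2)) * exp (- (1 / s))) (at s)"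
      using 3
      by (auto intro!: derivative_eq_intros DERIV_chain2[OF poly_DERIV] simp: power2_eq_square)
    then have "(flat_exp p has_real_derivative
        poly p (1 / s) * (exp (- (1 / s)) * (1 / s\<^sup>2)) + poly (pderiv p) (1 / s) * (- (1 / s\<^sup>2)) * exp (- (1 / s))) (at s)"
      by (rule has_field_derivative_transform_within_open[of _ _ _ "{0<..}"])
        (use 3 in \<open>auto simp: flat_exp_def\<close>)
    then show ?thesis
      by (rule DERIV_cong) (use 3 in \<open>simp add: flat_exp_def field_simps power2_eq_square\<close>)
  qed
qed

lemma isCont_flat_exp: "isCont (flat_exp p) s"
  using has_derivative_flat_exp by (rule DERIV_isCont)

lemma flat_exp_minus: "flat_exp (- p) s = - flat_exp p s"
  by (simp add: flat_exp_def)

section \<open>A bump function on the interval from 1 to 2 and its antiderivative\<close>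

definition bump :: "real \<Rightarrow> real" where
  "bump s = flat_exp 1 (s - 1) * flat_exp 1 (2 - s)"

lemma bump_eq_0: "s \<notin> {1<..<2} \<Longrightarrow> bump s = 0"
  by (auto simp: bump_def flat_exp_def)

lemma bump_pos: "s \<in> {1<..<2} \<Longrightarrow> bump s > 0"
  by (simp add: bump_def flat_exp_def)

lemma bump_bounds: "0 \<le> bump s" "bump s \<le> 1"
proof -
  have "0 \<le> flat_exp 1 s \<and> flat_exp 1 s \<le> 1" for s by (simp add: flat_exp_def)
  then show "0 \<le> bump s" "bump s \<le> 1" by (auto simp: bump_def intro: mult_le_one)
qed

text \<open>\<open>bump\<close> is a product of a translated and a reflected flat function.
  Adjoining \<open>g\<close> to the algebra that these families generate keeps it closed under
  differentiation.\<close>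

lemma smooth_antiderivative_bump:
  assumes g: "\<And>s. (g has_real_derivative bump s) (at s)"
  shows "smooth g"
proof -
  define S where "S = range (\<lambda>p s. flat_exp p (s - 1)) \<union> range (\<lambda>p s. flat_exp p (2 - s))"
  have S: "\<exists>f'\<in>S. \<forall>s. (f has_real_derivative f' s) (at s)" if "f \<in> S" for f
  proof -
    from that consider p where "f = (\<lambda>s. flat_exp p (s - 1))" | p where "f = (\<lambda>s. flat_exp p (2 - s))"
      by (auto simp: S_def)
    then show ?thesis
    proof cases
      case 1
      let ?q = "[:0, 0, 1:] * (p - pderiv p)"
      have "(f has_real_derivative flat_exp ?q (s - 1) * 1) (at s)" for s
        unfolding 1 by (rule DERIV_chain2[OF has_derivative_flat_exp]) (auto intro!: derivative_eq_intros)
      then show ?thesis by (intro bexI[of _ "\<lambda>s. flat_exp ?q (s - 1)"]) (auto simp: S_def)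
    next
      case 2
      define q where "q = [:0, 0, 1:] * (p - pderiv p)"
      have "(f has_real_derivative flat_exp q (2 - s) * (-1)) (at s)" for s
        unfolding 2 q_def
        by (rule DERIV_chain2[OF has_derivative_flat_exp]) (auto intro!: derivative_eq_intros)
      \<comment> \<open>The inner derivative -1 is absorbed by negating the polynomial, so the
        derivative is again a generator.\<close>
      then have "\<forall>s. (f has_real_derivative flat_exp (- q) (2 - s)) (at s)"
        by (simp add: flat_exp_minus)
      then show ?thesis
        by (intro bexI[of _ "\<lambda>s. flat_exp (- q) (2 - s)"]) (auto simp: S_def)
    qed
  qed
  have "bump \<in> algebra_hull S"
    unfolding bump_def[abs_def]
    by (intro algebra_hull.mult algebra_hull.base) (auto simp: S_def)
  then show ?thesis
    using algebra_hull_closed_under_derivative[OF _ S] g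
    by (intro smooth_coinduct[of _ "insert g (algebra_hull S)"]) blast+
qed

text \<open>The antiderivative of \<open>bump\<close> that vanishes at 1 works: \<open>bump\<close>
  lives away from 0, has values in [0, 1] and is positive between 1 and 2.\<close>

lemma P0_nontrivial: "\<exists>g\<in>P0. (\<forall>s\<le>1. g s = 0) \<and> g 2 > 0"
proof -
  have "isCont bump s" for s
    unfolding bump_def[abs_def]
    by (intro isCont_mult isCont_o2[OF _ isCont_flat_exp] isCont_diff continuous_ident continuous_const)
  then obtain G where G: "(G has_real_derivative bump s) (at s)" for s
    using einterval_antiderivative[of "-\<infinity>" "\<infinity>" bump]
    by (auto simp: has_real_derivative_iff_has_vector_derivative)
  define g where "g s = G s - G 1" for s
  have g: "(g has_real_derivative bump s) (at s)" for s
    unfolding g_def[abs_def] using G[of s] by (auto intro!: derivative_eq_intros)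
  have cont: "continuous_on A g" for A
    using g by (meson DERIV_isCont continuous_at_imp_continuous_on)
  have dg: "deriv g = bump" using g by (auto intro: DERIV_imp_deriv)
  have g0: "g s = 0" if "s \<le> 1" for s
  proof (cases "s = 1")
    case False
    have g': "(g has_real_derivative 0) (at r)" if "r < 1" for r
      using g[of r] bump_eq_0[of r] that by simp
    have "g 1 = g s"
      by (rule DERIV_isconst_end[of s 1 g]) (use that False cont g' in auto)
    then show ?thesis by (simp add: g_def)
  qed (simp add: g_def)
  have "g 1 < g 2"
    by (rule DERIV_pos_imp_increasing_open[of 1 2 g]) (use g bump_pos cont in \<open>force+\<close>)
  then have "g 2 > 0" using g0 by simp
  have "spt g \<subseteq> {1..}"
    unfolding spt_def using g0 by (intro closure_minimal) (auto intro: leI)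
  moreover have "spt bump \<subseteq> {1..2}"
    unfolding spt_def by (intro closure_minimal) (auto intro: ccontr simp: bump_def flat_exp_def split: if_splits)
  then have "compact (spt bump)"
    by (metis bounded_closed_interval bounded_subset closed_closure compact_eq_bounded_closed spt_def)
  ultimately have "g \<in> P0"
    using smooth_antiderivative_bump[OF g] bump_bounds by (auto simp: P0_def dg)
  then show ?thesis using g0 \<open>g 2 > 0\<close> by blast
qed

section \<open>Functions on a two-point probability space\<close>

context
  fixes \<Omega> :: "'a::t1_space set" and x y :: 'a
  assumes x: "x \<in> \<Omega>" and y: "y \<in> \<Omega>" and xy: "x \<noteq> y"
begin

private abbreviation "M \<equiv> two_point_measure \<Omega> x y"

lemma singleton_sets_two_point: "z \<in> \<Omega> \<Longrightarrow> {z} \<in> sets (restrict_space borel \<Omega>)"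
  by (auto simp: sets_restrict_space intro!: image_eqI[of _ _ "{z}"])

text \<open>Both points are atoms, hence lie in no null set, and the rest of \<open>\<Omega>\<close>
  is null.\<close>

lemma AE_two_point_iff: "(AE w in M. P w) \<longleftrightarrow> P x \<and> P y"
proof
  assume "AE w in M. P w"
  then obtain N where N: "{w \<in> space M. \<not> P w} \<subseteq> N" "emeasure M N = 0" "N \<in> sets M"
    by (rule AE_E)
  from N(2,3) have "x \<notin> N \<and> y \<notin> N"
    by (auto simp: emeasure_two_point_measure ennreal_divide_eq_0_iff split: split_indicator_asm)
  with N(1) x y show "P x \<and> P y" by auto
next
  assume P: "P x \<and> P y"
  have "\<Omega> - {x, y} \<in> sets (restrict_space borel \<Omega>)"
    by (auto simp: sets_restrict_space
        intro!: image_eqI[of _ _ "- {x, y}"] borel_open open_Compl finite_imp_closed)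
  with P show "AE w in M. P w"
    by (intro AE_I[of _ _ "\<Omega> - {x, y}"]) (auto simp: emeasure_two_point_measure)
qed

lemma integral_two_point:
  fixes f :: "'a \<Rightarrow> real"
  assumes [measurable]: "f \<in> borel_measurable M"
  shows "(LINT w|M. f w) = (f x + f y) / 2"
proof -
  have s[measurable]: "{x} \<in> sets M" "{y} \<in> sets M"
    using x y by (auto intro: singleton_sets_two_point)
  have e: "emeasure M {x} = 1 / 2" "emeasure M {y} = 1 / 2"
    using s xy by (auto simp: emeasure_two_point_measure)
  moreover have "ennreal (1 / 2) = 1 / 2"
    by (metis divide_ennreal ennreal_1 ennreal_numeral zero_le_one zero_less_numeral)
  ultimately have m: "measure M {x} = 1 / 2" "measure M {y} = 1 / 2"
    by (intro measure_eq_emeasure_eq_ennreal; simp only: divide_nonneg_pos zero_le_one zero_less_numeral)+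
  have f: "emeasure M {x} < \<infinity>" "emeasure M {y} < \<infinity>"
    by (auto simp: e ennreal_divide_eq_top_iff less_top[symmetric])
  \<comment> \<open>Almost everywhere \<open>f\<close> equals a simple function carried by the two
    atoms.\<close>
  have "(LINT w|M. f w) = (LINT w|M. f x * indicator {x} w + f y * indicator {y} w)"
    by (intro integral_cong_AE) (use xy in \<open>auto simp: AE_two_point_iff\<close>)
  also have "\<dots> = f x * measure M {x} + f y * measure M {y}"
    using s f x y by (subst Bochner_Integration.integral_add) (auto simp: Int_absorb1)
  finally show ?thesis by (simp add: m add_divide_distrib)
qed

lemma L2_norm_two_point:
  assumes "f \<in> borel_measurable M"
  shows "(L2_norm M f)\<^sup>2 = ((f x)\<^sup>2 + (f y)\<^sup>2) / 2"
  using assms by (simp add: L2_norm_def integral_two_point)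

section \<open>Point evaluations as continuous coordinates on \<open>L2_space M\<close>\<close>

definition eval_at :: "'a \<Rightarrow> ('a \<Rightarrow> real) set \<Rightarrow> real" where
  "eval_at z U = (SOME u. u \<in> U) z"

text \<open>At an atom all representatives of a class agree, so the arbitrary choice in
  \<open>eval_at\<close> is harmless there.\<close>

lemma eval_at_ae_class:
  assumes "u \<in> borel_measurable M" "z \<in> {x, y}"
  shows "eval_at z (ae_class M u) = u z"
proof -
  have "AE w in M. (SOME v. v \<in> ae_class M u) w = u w"
    using some_ae_class[OF assms(1)] by (simp add: ae_class_def)
  then show ?thesis using assms(2) by (auto simp: AE_two_point_iff eval_at_def)
qed

text \<open>Each atom has mass 1/2, so the square of one coordinate is at most twice the squared
  norm.\<close>

lemma eval_at_Lipschitz: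
  assumes "U \<in> L2_space M" "V \<in> L2_space M" "z \<in> {x, y}"
  shows "\<bar>eval_at z U - eval_at z V\<bar> \<le> sqrt 2 * L2_dist M U V"
proof -
  obtain u v where uv: "u \<in> borel_measurable M" "U = ae_class M u"
    "v \<in> borel_measurable M" "V = ae_class M v"
    using assms by (auto simp: L2_space_def square_integrable_def)
  have "(u z - v z)\<^sup>2 \<le> 2 * (L2_norm M (\<lambda>w. u w - v w))\<^sup>2"
    using uv assms(3) by (auto simp: L2_norm_two_point)
  then have "\<bar>u z - v z\<bar> \<le> sqrt (2 * (L2_norm M (\<lambda>w. u w - v w))\<^sup>2)"
    by (simp add: real_le_rsqrt)
  also have "\<dots> = sqrt 2 * L2_norm M (\<lambda>w. u w - v w)"
    by (simp add: real_sqrt_mult L2_norm_def)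
  finally show ?thesis using uv assms(3) by (simp add: eval_at_ae_class L2_dist_ae_class)
qed

lemma continuous_map_eval_at:
  assumes "z \<in> {x, y}"
  shows "continuous_map (L2_topology M) euclideanreal (eval_at z)"
proof -
  interpret L2: Metric_space "L2_space M" "L2_dist M" by (rule Metric_space_L2)
  show ?thesis
    unfolding L2_topology_def mtopology_is_euclidean[symmetric]
  proof (subst L2.metric_continuous_map[OF Met_TC.Metric_space_axioms], intro conjI ballI allI impI)
    fix U and e :: real assume U: "U \<in> L2_space M" and e: "0 < e"
    have "dist (eval_at z U) (eval_at z V) < e" if "V \<in> L2_space M" "L2_dist M U V < e / sqrt 2" for V
      using eval_at_Lipschitz[OF U that(1) assms] that(2) by (simp add: dist_real_def field_simps)
    with e show "\<exists>d>0. \<forall>V. V \<in> L2_space M \<and> L2_dist M U V < d \<longrightarrow> dist (eval_at z U) (eval_at z V) < e"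
      by (intro exI[of _ "e / sqrt 2"]) auto
  qed auto
qed

section \<open>The quadratic counterexample\<close>

definition correlated :: "real \<Rightarrow> ('a \<Rightarrow> real) set \<Rightarrow> real" where
  "correlated l U = l / 4 * ((eval_at x U)\<^sup>2 + (eval_at y U)\<^sup>2) + (l + 1) * (eval_at x U + eval_at y U)\<^sup>2"

lemma correlated_ae_class:
  "u \<in> borel_measurable M \<Longrightarrow>
    correlated l (ae_class M u) = l / 4 * ((u x)\<^sup>2 + (u y)\<^sup>2) + (l + 1) * (u x + u y)\<^sup>2"
  by (simp add: correlated_def eval_at_ae_class)

lemma continuous_map_correlated: "continuous_map (L2_topology M) euclideanreal (correlated l)"
  unfolding correlated_def[abs_def]
  by (intro continuous_map_add continuous_map_real_mult continuous_map_real_pow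
      continuous_map_canonical_const continuous_map_eval_at) auto

lemma lambda_convex_correlated:
  assumes "l \<ge> 0"
  shows "lambda_convex_L2 M l (\<lambda>U. ereal (correlated l U))"
  unfolding lambda_convex_L2_def
proof (intro ballI)
  fix u v and t :: real
  assume "u \<in> square_integrable M" "v \<in> square_integrable M" and t: "t \<in> {0..1}"
  then have [measurable]: "u \<in> borel_measurable M" "v \<in> borel_measurable M"
    by (auto simp: square_integrable_def)
  have norm: "(L2_norm M (\<lambda>w. u w - v w))\<^sup>2 = ((u x - v x)\<^sup>2 + (u y - v y)\<^sup>2) / 2"
    by (simp add: L2_norm_two_point)
  \<comment> \<open>For a quadratic form the convexity defect at \<open>u\<close>, \<open>v\<close>
    is \<open>t * (1 - t)\<close> times its value at \<open>u - v\<close>. The defect of the first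
    summand is exactly the \<open>l\<close>-term, which leaves that of
    \<open>(l + 1) * (a + b)^2\<close>.\<close>
  have "0 \<le> (l + 1) * (t * (1 - t) * ((u x + u y) - (v x + v y))\<^sup>2)"
    using t assms by auto
  also have "\<dots> = t * correlated l (ae_class M u) + (1 - t) * correlated l (ae_class M v)
      - 1 / 2 * l * t * (1 - t) * (L2_norm M (\<lambda>w. u w - v w))\<^sup>2
      - correlated l (ae_class M (\<lambda>w. t * u w + (1 - t) * v w))"
    by (simp add: norm correlated_ae_class) (simp add: field_simps power2_eq_square)
  finally show "ereal (correlated l (ae_class M (\<lambda>w. t * u w + (1 - t) * v w)))
      \<le> ereal t * ereal (correlated l (ae_class M u))
        + ereal (1 - t) * ereal (correlated l (ae_class M v))
        - ereal (1 / 2 * l * t * (1 - t) * (L2_norm M (\<lambda>w. u w - v w))\<^sup>2)"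
    by simp
qed

lemma not_P0_convex_correlated:
  assumes "l \<ge> 0"
  shows "\<not> P0_convex_on M (L2_space M) (\<lambda>U. ereal (correlated l U))"
proof
  assume P: "P0_convex_on M (L2_space M) (\<lambda>U. ereal (correlated l U))"
  obtain g where g: "g \<in> P0" "g 2 > 0" "g (-4) = 0" using P0_nontrivial by force
  have "g differentiable_on UNIV"
    using g(1) funpow_0 unfolding P0_def smooth_def by (metis (mono_tags, lifting) mem_Collect_eq)
  then have [measurable]: "g \<in> borel_measurable borel"
    by (intro borel_measurable_continuous_onI differentiable_imp_continuous_on)
  \<comment> \<open>With \<open>u = 0\<close> this realises \<open>v - u = (2, -4)\<close>;
    \<open>g\<close> keeps the first coordinate and kills the second.\<close>
  define v where "v w = 6 * indicator {x} w - (4::real)" for w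
  have [measurable]: "{x} \<in> sets M" using x by (simp add: singleton_sets_two_point)
  have [measurable]: "v \<in> borel_measurable M" unfolding v_def[abs_def] by measurable
  have v: "v x = 2" "v y = -4" using xy by (auto simp: v_def)
  have "ae_class M u \<in> L2_space M" if "u \<in> borel_measurable M" for u
    using that L2_space_two_point_measure[OF x y] by (simp add: F_space_def)
  then have "correlated l (ae_class M (\<lambda>w. g (v w))) + correlated l (ae_class M (\<lambda>w. v w - g (v w)))
      \<le> correlated l (ae_class M (\<lambda>w. 0)) + correlated l (ae_class M v)"
    using P[unfolded P0_convex_on_def, rule_format, of "\<lambda>w. 0" v g] g(1) by simp
  \<comment> \<open>Since \<open>v = p + q\<close> with \<open>p = (g 2, 0)\<close> and
    \<open>q = (2 - g 2, -4)\<close>, the inequality reduces to the polarised term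
    \<open>2 * B(p, q)\<close> being nonnegative.\<close>
  then have "0 \<le> 2 * g 2 * (l / 4 * (2 - g 2) + (l + 1) * (- 2 - g 2))"
    by (simp add: correlated_ae_class v g field_simps power2_eq_square)
  \<comment> \<open>The weight \<open>l + 1\<close> is large enough for the negative contribution
    \<open>-2 * (l + 1)\<close> to beat \<open>l / 2\<close>, and it is still positive at
    \<open>l = 0\<close>.\<close>
  moreover have "l / 4 * (2 - g 2) + (l + 1) * (- 2 - g 2) < 0"
  proof -
    have "l / 4 * (2 - g 2) + (l + 1) * (- 2 - g 2) = - (3 / 2 * l + 2 + 5 / 4 * (l * g 2) + g 2)"
      by (simp add: algebra_simps)
    moreover have "l * g 2 \<ge> 0" using assms g by simp
    ultimately show ?thesis using assms g by linarith
  qed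
  ultimately show False using g(2) by (simp add: zero_le_mult_iff)
qed

end

theorem proposition4p8:
  fixes \<Omega> :: "(real ^ 'd) set" and x y :: "real ^ 'd"
    and \<mu> :: "(real ^ 'd) measure"
  assumes "open \<Omega>" and "x \<in> \<Omega>" and "y \<in> \<Omega>" and "x \<noteq> y"
    and "\<mu> = two_point_measure \<Omega> x y"
  shows "\<forall>l::real. l \<ge> 0 \<longrightarrow>
    (\<exists>\<Phi> :: (real ^ 'd \<Rightarrow> real) set \<Rightarrow> real.
       continuous_map (L2_topology \<mu>) euclideanreal \<Phi> \<and>
       lambda_convex_L2 \<mu> l (\<lambda>U. ereal (\<Phi> U)) \<and>
       \<not> P0_convex_on \<mu> (L2_space \<mu>) (\<lambda>U. ereal (\<Phi> U)))"
  using continuous_map_correlated[OF assms(2-4)] lambda_convex_correlated[OF assms(2-4)]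
    not_P0_convex_correlated[OF assms(2-4)]
  unfolding assms(5) by blast

end
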